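(* Let $d,m\ge 1$, let $\mathbb{U}\subset\mathbb{R}^m$ be convex and compact, and let $v:\mathbb{R}^d\to\mathbb{U}$ be a Borel measurable map (a deterministic stationary Markov policy). Then there exists a family $\{\tilde v_{n,\eta}\}_{n\in\mathbb{N},\,\eta>0}$ of maps $\tilde v_{n,\eta}:\mathbb{R}^d\to\mathbb{U}$ (deterministic stationary Markov policies), each of which is Lipschitz continuous on $\mathbb{R}^d$ and smooth ($C^\infty$), such that for all $f\in L^1(\mathbb{R}^d)\cap L^2(\mathbb{R}^d)$ and all bounded continuous $g:\mathbb{R}^d\times\mathbb{U}\to\mathbb{R}$, $$\lim_{n\to\infty}\,\lim_{\eta\to 0}\int_{\mathbb{R}^d} f(x)\,g(x,\tilde v_{n,\eta}(x))\,dx=\int_{\mathbb{R}^d} f(x)\,g(x,v(x))\,dx .$$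
   Context: A deterministic stationary Markov policy is a policy of the form $x\mapsto\delta_{f(x)}\in\mathscr{P}(\mathbb{U})$ with $f:\mathbb{R}^d\to\mathbb{U}$ Borel measurable, where $\mathscr{P}(\mathbb{U})$ is the space of probability measures on $\mathbb{U}$; it is identified with the map $f$. Such a policy is called Lipschitz continuous (resp. smooth) if the map $f:\mathbb{R}^d\to\mathbb{U}\subset\mathbb{R}^m$ is Lipschitz continuous on $\mathbb{R}^d$ (resp. of class $C^\infty$). The convergence in the claim is convergence in the Borkar topology on stationary Markov policies, written out for deterministic policies. *)

theory Defs
  imports "HOL-Analysis.Analysis"
begin

text \<open>A deterministic stationary Markov policy, identified with the Borel map inducing it.
  The codomain carries the trace Borel sigma-algebra, so values in \<open>U\<close> are enforced.\<close>

definition det_stationary_policy ::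
    "'b set \<Rightarrow> ('a::topological_space \<Rightarrow> 'b::topological_space) \<Rightarrow> bool" where
  "det_stationary_policy U v \<longleftrightarrow> v \<in> borel \<rightarrow>\<^sub>M restrict_space borel U"

text \<open>Class \<open>C^k\<close> on the whole space. Iterating directional derivatives
  \<open>x \<mapsto> Df(x) h\<close> over all directions \<open>h\<close> avoids the spaces of multilinear maps; on a
  finite-dimensional domain it agrees with continuity of the iterated total derivatives.\<close>

primrec C_k :: "nat \<Rightarrow> ('a::real_normed_vector \<Rightarrow> 'b::real_normed_vector) \<Rightarrow> bool" where
  "C_k 0 f \<longleftrightarrow> continuous_on UNIV f"
| "C_k (Suc k) f \<longleftrightarrow>
     (\<forall>x. f differentiable (at x)) \<and> (\<forall>h. C_k k (\<lambda>x. frechet_derivative f (at x) h))"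

definition smooth :: "('a::real_normed_vector \<Rightarrow> 'b::real_normed_vector) \<Rightarrow> bool" where
  "smooth f \<longleftrightarrow> (\<forall>k. C_k k f)"

end

theory Submission
  imports Defs
begin

text \<open>
  It suffices to find smooth Lipschitz maps \<open>w n\<close> into \<open>U\<close> that converge to \<open>v\<close> almost
  everywhere: the integrands \<open>f x * g (x, w n x)\<close> are then dominated by a multiple of \<open>\<bar>f x\<bar>\<close>
  and converge almost everywhere by continuity of \<open>g\<close>, so the integrals converge
  (\<open>integral_tendsto_AE_policies\<close>). The family indexed by \<open>n\<close> and \<open>\<eta>\<close> is taken constant
  in \<open>\<eta>\<close>, which makes the inner limit trivial.

  The maps \<open>w n\<close> arise in two steps (\<open>smooth_lipschitz_AE_limit\<close>). A measurable map is an
  almost everywhere limit of continuous maps, and composing these with the nearest-point projection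
  onto the closed convex set \<open>U\<close> keeps their values in \<open>U\<close> without changing the limit.
  Each continuous map \<open>G\<close> is then approximated uniformly on a large ball by a finite convex
  combination \<open>\<Sum>p\<in>P. s p x *\<^sub>R G p\<close> of its values on a fine net \<open>P\<close>, where the
  weights \<open>s p x\<close> are the Gaussians \<open>exp (- r * (norm (x - p))\<^sup>2)\<close>, normalised to have
  sum \<open>1\<close> (\<open>gauss_mean_approximates\<close>). Convexity of \<open>U\<close> keeps the values in \<open>U\<close>
  everywhere, not just on the ball.

  The normalised Gaussians serve well for two reasons. The factor
  \<open>exp (- r * (norm x)\<^sup>2)\<close> cancels, so they are the softmax of finitely many affine functions
  of \<open>x\<close>; and therefore the derivative of a weight is a polynomial in the weights. As the
  weights lie between \<open>0\<close> and \<open>1\<close>, this identity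
  (\<open>gauss_weight_has_derivative\<close>) gives both smoothness, by induction on the order, and a
  global Lipschitz constant.
\<close>

section \<open>Closure properties of the classes of k times differentiable maps\<close>

text \<open>These two rules avoid the chosen derivative \<^const>\<open>frechet_derivative\<close>, so that
  the usual calculus of \<^const>\<open>has_derivative\<close> applies.\<close>

lemma C_k_SucI:
  assumes "\<And>x. (f has_derivative f' x) (at x)"
    and "\<And>h. C_k k (\<lambda>x. f' x h)"
  shows "C_k (Suc k) f"
proof -
  have "frechet_derivative f (at x) = f' x" for x
    using assms(1)[of x] by (metis frechet_derivative_at)
  then show ?thesis
    using assms by (auto simp: differentiable_def)
qed

lemma C_k_SucE:
  assumes "C_k (Suc k) f"
  obtains f' where "\<And>x. (f has_derivative f' x) (at x)" and "\<And>h. C_k k (\<lambda>x. f' x h)"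
  using assms that[of "\<lambda>x. frechet_derivative f (at x)"]
  by (simp add: frechet_derivative_works)

lemma C_k_Suc_imp_C_k: "C_k (Suc k) f \<Longrightarrow> C_k k f"
proof (induction k arbitrary: f)
  case 0
  then show ?case
    by (auto simp: continuous_on_eq_continuous_at differentiable_imp_continuous_within)
next
  case (Suc k)
  then show ?case by (metis C_k.simps(2))
qed

lemma C_k_const: "C_k k (\<lambda>x. c)"
proof (induction k arbitrary: c)
  case (Suc k)
  show ?case by (rule C_k_SucI[where f' = "\<lambda>x h. 0"]) (use Suc in auto)
qed simp

lemma C_k_add: "C_k k f \<Longrightarrow> C_k k g \<Longrightarrow> C_k k (\<lambda>x. f x + g x)"
proof (induction k arbitrary: f g)
  case 0
  then show ?case by (simp add: continuous_on_add)
next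
  case (Suc k)
  from Suc.prems(1) obtain f' where f: "\<And>x. (f has_derivative f' x) (at x)" "\<And>h. C_k k (\<lambda>x. f' x h)"
    by (rule C_k_SucE) blast
  from Suc.prems(2) obtain g' where g: "\<And>x. (g has_derivative g' x) (at x)" "\<And>h. C_k k (\<lambda>x. g' x h)"
    by (rule C_k_SucE) blast
  show ?case
    by (rule C_k_SucI[where f' = "\<lambda>x h. f' x h + g' x h"])
      (auto intro!: has_derivative_add f g Suc.IH)
qed

lemma C_k_sum:
  "(\<And>i. i \<in> I \<Longrightarrow> C_k k (f i)) \<Longrightarrow> C_k k (\<lambda>x. \<Sum>i\<in>I. f i x)"
  by (induction I rule: infinite_finite_induct) (auto intro: C_k_add C_k_const)

text \<open>The product rule turns the derivative of a product into products of maps of class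
  \<open>C_k k\<close>; the undifferentiated factor is of that class by \<open>C_k_Suc_imp_C_k\<close>.\<close>

lemma C_k_bilinear:
  assumes "bounded_bilinear B"
  shows "C_k k f \<Longrightarrow> C_k k g \<Longrightarrow> C_k k (\<lambda>x. B (f x) (g x))"
proof (induction k arbitrary: f g)
  case 0
  then show ?case by (simp add: bounded_bilinear.continuous_on[OF assms])
next
  case (Suc k)
  from Suc.prems(1) obtain f' where f: "\<And>x. (f has_derivative f' x) (at x)" "\<And>h. C_k k (\<lambda>x. f' x h)"
    by (rule C_k_SucE) blast
  from Suc.prems(2) obtain g' where g: "\<And>x. (g has_derivative g' x) (at x)" "\<And>h. C_k k (\<lambda>x. g' x h)"
    by (rule C_k_SucE) blast
  have fg: "C_k k f" "C_k k g"
    using Suc.prems by (auto intro: C_k_Suc_imp_C_k)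
  show ?case
    by (rule C_k_SucI[where f' = "\<lambda>x h. B (f x) (g' x h) + B (f' x h) (g x)"])
      (auto intro!: bounded_bilinear.FDERIV[OF assms] C_k_add Suc.IH f g fg)
qed

lemmas C_k_mult = C_k_bilinear[OF bounded_bilinear_mult]
lemmas C_k_scaleR = C_k_bilinear[OF bounded_bilinear_scaleR]
lemmas C_k_inner = C_k_bilinear[OF bounded_bilinear_inner]

section \<open>Normalised Gaussian weights\<close>

text \<open>These are the Gaussians \<open>exp (- r * (norm (x - p))\<^sup>2)\<close>, normalised over \<open>p \<in> P\<close>, after
  cancelling the common factor \<open>exp (- r * (norm x)\<^sup>2)\<close>. In this form the exponents are affine
  in \<open>x\<close>.\<close>

definition gauss_weight :: "real \<Rightarrow> 'a::real_inner set \<Rightarrow> 'a \<Rightarrow> 'a \<Rightarrow> real" where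
  "gauss_weight r P p x =
     exp (r * (2 * (x \<bullet> p) - p \<bullet> p)) / (\<Sum>q\<in>P. exp (r * (2 * (x \<bullet> q) - q \<bullet> q)))"

definition gauss_mean :: "real \<Rightarrow> 'a::real_inner set \<Rightarrow> ('a \<Rightarrow> 'b::real_vector) \<Rightarrow> 'a \<Rightarrow> 'b" where
  "gauss_mean r P y x = (\<Sum>p\<in>P. gauss_weight r P p x *\<^sub>R y p)"

lemma gauss_weight_nonneg: "0 \<le> gauss_weight r P p x"
  unfolding gauss_weight_def by (simp add: sum_nonneg)

lemma sum_gauss_weight:
  assumes "finite P" "P \<noteq> {}"
  shows "(\<Sum>p\<in>P. gauss_weight r P p x) = 1"
proof -
  have "(\<Sum>q\<in>P. exp (r * (2 * (x \<bullet> q) - q \<bullet> q))) > 0"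
    using assms by (intro sum_pos) auto
  then show ?thesis
    unfolding gauss_weight_def by (simp flip: sum_divide_distrib)
qed

lemma gauss_weight_le_1:
  assumes "finite P" "p \<in> P"
  shows "gauss_weight r P p x \<le> 1"
proof -
  have "P \<noteq> {}" using assms by auto
  then show ?thesis
    using member_le_sum[of p P "\<lambda>p. gauss_weight r P p x"] sum_gauss_weight[of P r x] assms
    by (simp add: gauss_weight_nonneg)
qed

text \<open>Bounding the denominator below by its summand at \<open>q\<close> leaves a quotient of two Gaussians.
  Hence, for large \<open>r\<close>, a point much farther from \<open>x\<close> than some other point of \<open>P\<close> gets a
  negligible weight.\<close>

lemma gauss_weight_le:
  assumes "finite P" "q \<in> P"
  shows "gauss_weight r P p x \<le> exp (r * ((norm (x - q))\<^sup>2 - (norm (x - p))\<^sup>2))"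
proof -
  have "gauss_weight r P p x
      \<le> exp (r * (2 * (x \<bullet> p) - p \<bullet> p)) / exp (r * (2 * (x \<bullet> q) - q \<bullet> q))"
    unfolding gauss_weight_def using assms
    by (intro divide_left_mono member_le_sum mult_pos_pos sum_pos) auto
  also have "\<dots> = exp (r * ((norm (x - q))\<^sup>2 - (norm (x - p))\<^sup>2))"
    by (simp add: exp_diff[symmetric] power2_norm_eq_inner inner_diff_left inner_diff_right
        inner_commute algebra_simps)
  finally show ?thesis .
qed

text \<open>This is the differential equation of the softmax function. Its right-hand side is a
  quadratic polynomial in the weights, since \<^const>\<open>gauss_mean\<close> is linear in them.\<close>

lemma gauss_weight_has_derivative:
  fixes P :: "'a::real_inner set"
  assumes "finite P" "P \<noteq> {}"
  shows "(gauss_weight r P p has_derivative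
    (\<lambda>h. 2 * r * gauss_weight r P p x * (h \<bullet> (p - gauss_mean r P (\<lambda>q. q) x)))) (at x)"
proof -
  define E where "E q x = exp (r * (2 * (x \<bullet> q) - q \<bullet> q))" for q x :: 'a
  define S where "S x = (\<Sum>q\<in>P. E q x)" for x
  have S: "S x > 0" for x
    unfolding S_def E_def using assms by (intro sum_pos) auto
  have E': "(E q has_derivative (\<lambda>h. 2 * r * E q x * (h \<bullet> q))) (at x)" for q x
    unfolding E_def by (auto intro!: derivative_eq_intros simp: algebra_simps)
  have S': "(S has_derivative (\<lambda>h. \<Sum>q\<in>P. 2 * r * E q x * (h \<bullet> q))) (at x)"
    unfolding S_def by (intro has_derivative_sum E')
  have w: "gauss_weight r P q x = E q x / S x" for q x
    by (simp add: gauss_weight_def S_def E_def)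
  have "((\<lambda>x. E p x / S x) has_derivative
     (\<lambda>h. - E p x * (inverse (S x) * (\<Sum>q\<in>P. 2 * r * E q x * (h \<bullet> q)) * inverse (S x)) +
        2 * r * E p x * (h \<bullet> p) / S x)) (at x)"
    using has_derivative_divide[OF E'[of p x] S'] S[of x] by simp
  moreover have "- E p x * (inverse (S x) * (\<Sum>q\<in>P. 2 * r * E q x * (h \<bullet> q)) * inverse (S x)) +
        2 * r * E p x * (h \<bullet> p) / S x
      = 2 * r * gauss_weight r P p x * (h \<bullet> (p - gauss_mean r P (\<lambda>q. q) x))" for h
  proof -
    have "h \<bullet> gauss_mean r P (\<lambda>q. q) x = (\<Sum>q\<in>P. E q x * (h \<bullet> q)) / S x"
      by (simp add: gauss_mean_def w inner_sum_right sum_divide_distrib)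
    moreover have "(\<Sum>q\<in>P. 2 * r * E q x * (h \<bullet> q)) = 2 * r * (\<Sum>q\<in>P. E q x * (h \<bullet> q))"
      by (simp add: sum_distrib_left mult.assoc)
    ultimately show ?thesis
      using S[of x] by (simp add: w inner_diff_right field_simps)
  qed
  moreover have "gauss_weight r P p = (\<lambda>x. E p x / S x)"
    by (simp add: w fun_eq_iff)
  ultimately show ?thesis by simp
qed

text \<open>If all weights are of class \<open>C_k k\<close>, then so is each derivative of a weight, being a
  polynomial in them. The induction therefore has to treat all points \<open>p\<close> at once.\<close>

lemma C_k_gauss_weight:
  fixes P :: "'a::real_inner set"
  assumes "finite P" "P \<noteq> {}"
  shows "C_k k (gauss_weight r P p)"
proof (induction k arbitrary: p)
  case 0
  show ?case
    using gauss_weight_has_derivative[OF assms]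
    by (auto intro!: continuous_at_imp_continuous_on has_derivative_continuous)
next
  case (Suc k)
  have mean: "C_k k (gauss_mean r P (\<lambda>q. q))"
    unfolding gauss_mean_def[abs_def] by (intro C_k_sum C_k_scaleR C_k_const Suc.IH)
  have "C_k k (\<lambda>x. p - gauss_mean r P (\<lambda>q. q) x)"
    using C_k_add[OF C_k_const[where c = p] C_k_scaleR[OF C_k_const[where c = "-1"] mean]] by simp
  then have "C_k k (\<lambda>x. 2 * r * gauss_weight r P p x * (h \<bullet> (p - gauss_mean r P (\<lambda>q. q) x)))" for h
    by (intro C_k_mult C_k_inner C_k_const Suc.IH)
  then show ?case
    by (rule C_k_SucI[OF gauss_weight_has_derivative[OF assms]])
qed

lemma smooth_gauss_mean:
  fixes P :: "'a::real_inner set" and y :: "'a \<Rightarrow> 'b::real_normed_vector"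
  assumes "finite P" "P \<noteq> {}"
  shows "smooth (gauss_mean r P y)"
  unfolding smooth_def gauss_mean_def[abs_def]
  by (intro allI C_k_sum C_k_scaleR C_k_const C_k_gauss_weight assms)

lemma gauss_mean_in_convex:
  assumes "convex U" "finite P" "P \<noteq> {}" "\<And>p. p \<in> P \<Longrightarrow> y p \<in> U"
  shows "gauss_mean r P y x \<in> U"
  unfolding gauss_mean_def
  by (rule convex_sum[OF assms(2,1)]) (use assms in \<open>auto simp: sum_gauss_weight gauss_weight_nonneg\<close>)

text \<open>The derivative of each weight is bounded, because the weight is at most \<open>1\<close> and the mean of
  the points stays in any ball around the origin that contains \<open>P\<close>.\<close>

lemma lipschitz_gauss_mean:
  fixes P :: "'a::real_inner set" and y :: "'a \<Rightarrow> 'b::real_normed_vector"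
  assumes "finite P" "P \<noteq> {}"
  shows "\<exists>L. L-lipschitz_on UNIV (gauss_mean r P y)"
proof -
  obtain M where M: "M > 0" "\<And>p. p \<in> P \<Longrightarrow> norm p \<le> M"
    using finite_imp_bounded[OF assms(1)] by (auto simp: bounded_pos)
  have mean: "norm (gauss_mean r P (\<lambda>q. q) x) \<le> M" for x
    using gauss_mean_in_convex[of "cball 0 M" P "\<lambda>q. q" r x] assms M by auto
  define G where "G p x h = 2 * r * gauss_weight r P p x * (h \<bullet> (p - gauss_mean r P (\<lambda>q. q) x))"
    for p x h
  define L where "L = (\<Sum>p\<in>P. 2 * \<bar>r\<bar> * (2 * M) * norm (y p))"
  have L: "L \<ge> 0"
    unfolding L_def using M by (intro sum_nonneg) auto
  have G: "\<bar>G p x h\<bar> \<le> 2 * \<bar>r\<bar> * (2 * M) * norm h" if "p \<in> P" for p x h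
  proof -
    have "\<bar>h \<bullet> (p - gauss_mean r P (\<lambda>q. q) x)\<bar> \<le> norm h * norm (p - gauss_mean r P (\<lambda>q. q) x)"
      by (rule Cauchy_Schwarz_ineq2)
    also have "\<dots> \<le> norm h * (2 * M)"
      using norm_triangle_ineq4[of p "gauss_mean r P (\<lambda>q. q) x"] mean[of x] M(2)[OF that]
      by (intro mult_left_mono) auto
    finally have "gauss_weight r P p x * \<bar>h \<bullet> (p - gauss_mean r P (\<lambda>q. q) x)\<bar> \<le> 1 * (norm h * (2 * M))"
      using gauss_weight_le_1[OF assms(1) that, of r x] gauss_weight_nonneg[of r P p x]
      by (intro mult_mono) auto
    then have "2 * \<bar>r\<bar> * (gauss_weight r P p x * \<bar>h \<bullet> (p - gauss_mean r P (\<lambda>q. q) x)\<bar>)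
        \<le> 2 * \<bar>r\<bar> * (1 * (norm h * (2 * M)))"
      by (intro mult_left_mono) auto
    then show ?thesis
      using gauss_weight_nonneg[of r P p x] by (simp add: G_def abs_mult mult_ac)
  qed
  have "norm (gauss_mean r P y a - gauss_mean r P y b) \<le> L * norm (a - b)" for a b
  proof (rule differentiable_bound[where S = UNIV and f' = "\<lambda>x h. \<Sum>p\<in>P. G p x h *\<^sub>R y p"])
    show "(gauss_mean r P y has_derivative (\<lambda>h. \<Sum>p\<in>P. G p x h *\<^sub>R y p)) (at x within UNIV)" for x
    proof -
      have "((\<lambda>x. \<Sum>p\<in>P. gauss_weight r P p x *\<^sub>R y p) has_derivative
          (\<lambda>h. \<Sum>p\<in>P. G p x h *\<^sub>R y p)) (at x)"
        unfolding G_def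
        by (intro has_derivative_sum has_derivative_scaleR_left gauss_weight_has_derivative assms)
      then show ?thesis by (simp add: gauss_mean_def[abs_def])
    qed
    show "onorm (\<lambda>h. \<Sum>p\<in>P. G p x h *\<^sub>R y p) \<le> L" for x
    proof (rule onorm_bound[OF L])
      fix h
      have "norm (\<Sum>p\<in>P. G p x h *\<^sub>R y p) \<le> (\<Sum>p\<in>P. 2 * \<bar>r\<bar> * (2 * M) * norm h * norm (y p))"
        by (rule sum_norm_le) (simp only: norm_scaleR real_norm_def mult_right_mono G norm_ge_zero)
      then show "norm (\<Sum>p\<in>P. G p x h *\<^sub>R y p) \<le> L * norm h"
        by (simp add: L_def sum_distrib_left mult_ac)
    qed
  qed auto
  then have "L-lipschitz_on UNIV (gauss_mean r P y)"
    by (auto intro!: lipschitz_onI L simp: dist_norm)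
  then show ?thesis ..
qed

section \<open>Approximation of continuous and of measurable maps\<close>

text \<open>The error at \<open>x\<close> is the weighted mean of the differences \<open>g p - g x\<close>. For \<open>p\<close> within
  \<open>d\<close> of \<open>x\<close> these are small by uniform continuity. The remaining \<open>p\<close> have negligible
  weight by comparison with a point \<open>q\<close> of the net at distance less than \<open>d/2\<close>.\<close>

lemma gauss_mean_approximates:
  fixes g :: "'a::real_inner \<Rightarrow> 'b::real_normed_vector"
  assumes K: "compact K" "K \<noteq> {}" and g: "continuous_on K g" and e: "e > 0"
  shows "\<exists>P r. finite P \<and> P \<noteq> {} \<and> P \<subseteq> K \<and> (\<forall>x\<in>K. norm (gauss_mean r P g x - g x) < e)"
proof -
  have "uniformly_continuous_on K g"
    by (rule compact_uniformly_continuous[OF g K(1)])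
  then obtain d where d: "d > 0"
    and unif: "\<And>x p. x \<in> K \<Longrightarrow> p \<in> K \<Longrightarrow> dist p x < d \<Longrightarrow> dist (g p) (g x) < e/2"
    using half_gt_zero[OF e] unfolding uniformly_continuous_on_def by blast
  obtain P where P: "finite P" "P \<subseteq> K" "K \<subseteq> (\<Union>p\<in>P. ball p (d/2))"
    using compactE_image[OF K(1), of K "\<lambda>p. ball p (d/2)"] d
    by (metis (no_types, lifting) UN_I centre_in_ball half_gt_zero open_ball subsetI)
  have "P \<noteq> {}" using P(3) K(2) by auto
  obtain B where B: "B > 0" "\<And>x. x \<in> K \<Longrightarrow> norm (g x) \<le> B"
    using compact_imp_bounded[OF compact_continuous_image[OF g K(1)]] by (auto simp: bounded_pos)
  \<comment> \<open>Points beyond distance \<open>d\<close> have weight at most \<open>exp (- r * c)\<close>, where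
    \<open>c = d\<^sup>2 - (d/2)\<^sup>2\<close>. The parameter \<open>r\<close> is chosen to make this at most \<open>D\<close>, and \<open>D\<close> is so small
    that \<open>card P\<close> such terms, each with a factor of at most \<open>2 * B\<close>, add up to less than
    \<open>e/2\<close>. The absolute value keeps \<open>r\<close> nonnegative when \<open>D > 1\<close>.\<close>
  define c where "c = 3 / 4 * d\<^sup>2"
  define D where "D = e / (2 * (real (card P) * (2 * B) + 1))"
  define r where "r = \<bar>ln D\<bar> / c"
  have c: "c > 0" using d by (simp add: c_def)
  have D: "D > 0" using e B(1) by (simp add: D_def add_nonneg_pos)
  have "r \<ge> 0" using c by (simp add: r_def)
  have "exp (- (r * c)) \<le> exp (ln D)"
    using c by (simp add: r_def)
  then have rD: "exp (- (r * c)) \<le> D" using D by simp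
  have "norm (gauss_mean r P g x - g x) < e" if x: "x \<in> K" for x
  proof -
    obtain q where q: "q \<in> P" "norm (x - q) < d/2"
      using P(3) x by (force simp: dist_norm norm_minus_commute)
    have term_le: "gauss_weight r P p x * norm (g p - g x) \<le> gauss_weight r P p x * (e/2) + D * (2 * B)"
      if p: "p \<in> P" for p
    proof (cases "norm (x - p) < d")
      case True
      then have "gauss_weight r P p x * norm (g p - g x) \<le> gauss_weight r P p x * (e/2)"
        using unif[OF x, of p] P(2) p
        by (intro mult_left_mono gauss_weight_nonneg) (auto simp: dist_norm norm_minus_commute)
      then show ?thesis using D B(1) by (smt (verit) mult_nonneg_nonneg)
    next
      case False
      have "(norm (x - q))\<^sup>2 \<le> (d/2)\<^sup>2" using q(2) by (intro power_mono) auto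
      moreover have "d\<^sup>2 \<le> (norm (x - p))\<^sup>2" using False d by (intro power_mono) auto
      ultimately have "(norm (x - q))\<^sup>2 - (norm (x - p))\<^sup>2 \<le> - c"
        by (simp add: c_def power_divide)
      then have "r * ((norm (x - q))\<^sup>2 - (norm (x - p))\<^sup>2) \<le> r * - c"
        using \<open>r \<ge> 0\<close> by (intro mult_left_mono)
      then have "gauss_weight r P p x \<le> D"
        using gauss_weight_le[OF P(1) q(1), of r p x] rD
        by (smt (verit) exp_le_cancel_iff mult_minus_right)
      moreover have "norm (g p - g x) \<le> 2 * B"
        using norm_triangle_ineq4[of "g p" "g x"] B(2)[of p] B(2)[of x] p P(2) x by auto
      ultimately have "gauss_weight r P p x * norm (g p - g x) \<le> D * (2 * B)"
        using D by (intro mult_mono) auto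
      then show ?thesis
        using gauss_weight_nonneg[of r P p x] e by (smt (verit) half_gt_zero mult_nonneg_nonneg)
    qed
    have "gauss_mean r P g x - g x = (\<Sum>p\<in>P. gauss_weight r P p x *\<^sub>R (g p - g x))"
      using sum_gauss_weight[OF P(1) \<open>P \<noteq> {}\<close>, of r x]
      by (simp add: gauss_mean_def scaleR_diff_right sum_subtractf flip: scaleR_left.sum)
    also have "norm \<dots> \<le> (\<Sum>p\<in>P. gauss_weight r P p x * (e/2) + D * (2 * B))"
      by (rule sum_norm_le) (simp only: norm_scaleR abs_of_nonneg[OF gauss_weight_nonneg] term_le)
    also have "\<dots> = e/2 + real (card P) * (2 * B) * D"
      using sum_gauss_weight[OF P(1) \<open>P \<noteq> {}\<close>, of r x]
      by (simp only: sum.distrib flip: sum_distrib_right) (simp add: mult_ac)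
    also have "\<dots> < e/2 + (real (card P) * (2 * B) + 1) * D"
      using D by (simp add: algebra_simps)
    also have "\<dots> = e"
    proof -
      have "real (card P) * (2 * B) + 1 > 0" using B(1) by (simp add: add_nonneg_pos)
      then show ?thesis unfolding D_def by (simp add: field_simps)
    qed
    finally show ?thesis .
  qed
  then show ?thesis using P \<open>P \<noteq> {}\<close> by blast
qed

text \<open>The starting point is that \<open>measurable_on\<close> means being an almost everywhere limit of
  continuous maps \<open>g n\<close>. The map \<open>w n\<close> follows the projection of \<open>g n\<close> onto \<open>U\<close> up to
  \<open>1/(n+1)\<close> on the ball of radius \<open>n\<close>. Every point lies in all but finitely many of these
  balls, so \<open>w\<close> inherits the limit.\<close>

lemma smooth_lipschitz_AE_limit:
  fixes U :: "'b::euclidean_space set" and v :: "'a::euclidean_space \<Rightarrow> 'b"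
  assumes U: "convex U" "closed U" and v: "v \<in> borel_measurable lebesgue" "range v \<subseteq> U"
  shows "\<exists>w :: nat \<Rightarrow> 'a \<Rightarrow> 'b.
    (\<forall>n. range (w n) \<subseteq> U \<and> smooth (w n) \<and> (\<exists>L. L-lipschitz_on UNIV (w n))) \<and>
    (AE x in lebesgue. (\<lambda>n. w n x) \<longlonglongrightarrow> v x)"
proof -
  have Une: "U \<noteq> {}" using v(2) by auto
  have "v measurable_on UNIV"
    using v(1) by (intro lebesgue_measurable_imp_measurable_on) auto
  then obtain N g where N: "negligible N" and g: "\<And>n. continuous_on UNIV (g n)"
    and lim: "\<And>x. x \<notin> N \<Longrightarrow> (\<lambda>n. g n x) \<longlonglongrightarrow> v x"
    by (auto simp: measurable_on_def)
  define G where "G n x = closest_point U (g n x)" for n x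
  have contG: "continuous_on UNIV (G n)" for n
    unfolding G_def
    by (rule continuous_on_compose2[OF continuous_on_closest_point[OF U Une, of UNIV] g]) auto
  have GU: "G n x \<in> U" for n x
    unfolding G_def by (rule closest_point_in_set[OF U(2) Une])
  have limG: "(\<lambda>n. G n x) \<longlonglongrightarrow> v x" if "x \<notin> N" for x
  proof -
    have "(\<lambda>n. G n x) \<longlonglongrightarrow> closest_point U (v x)"
      unfolding G_def
      by (rule isCont_tendsto_compose[OF continuous_at_closest_point[OF U Une] lim[OF that]])
    moreover have "closest_point U (v x) = v x"
      using v(2) by (intro closest_point_self) auto
    ultimately show ?thesis by simp
  qed
  have "\<exists>P r. finite P \<and> P \<noteq> {} \<and> P \<subseteq> cball 0 (real n) \<and>
      (\<forall>x\<in>cball 0 (real n). norm (gauss_mean r P (G n) x - G n x) < inverse (real (Suc n)))" for n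
    using continuous_on_subset[OF contG[of n]] by (intro gauss_mean_approximates) auto
  then obtain P r where P: "\<And>n. finite (P n)" "\<And>n. P n \<noteq> {}"
    and approx: "\<And>n x. x \<in> cball 0 (real n) \<Longrightarrow>
      norm (gauss_mean (r n) (P n) (G n) x - G n x) < inverse (real (Suc n))"
    by metis
  define w where "w n = gauss_mean (r n) (P n) (G n)" for n
  have "(\<lambda>n. w n x) \<longlonglongrightarrow> v x" if "x \<notin> N" for x
  proof -
    have "eventually (\<lambda>n. norm (w n x - G n x) \<le> inverse (real (Suc n))) sequentially"
      using eventually_ge_at_top[of "nat \<lceil>norm x\<rceil>"]
    proof eventually_elim
      case (elim n)
      then have "x \<in> cball 0 (real n)" by (simp add: nat_le_iff ceiling_le_iff)
      then show ?case using approx[of x n] by (simp add: w_def)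
    qed
    then have "(\<lambda>n. w n x - G n x) \<longlonglongrightarrow> 0"
      by (rule Lim_null_comparison[OF _ LIMSEQ_inverse_real_of_nat])
    from tendsto_add[OF this limG[OF that]] show ?thesis by simp
  qed
  then have "AE x in lebesgue. (\<lambda>n. w n x) \<longlonglongrightarrow> v x"
    using N unfolding negligible_iff_null_sets by (intro AE_I'[of N]) auto
  moreover have "range (w n) \<subseteq> U" for n
    unfolding w_def using gauss_mean_in_convex[OF U(1) P GU] by auto
  moreover have "smooth (w n)" "\<exists>L. L-lipschitz_on UNIV (w n)" for n
    unfolding w_def by (auto intro!: smooth_gauss_mean lipschitz_gauss_mean P)
  ultimately show ?thesis by blast
qed

section \<open>Convergence of the integrals\<close>

text \<open>By dominated convergence with the bound \<open>\<bar>f x\<bar> * B\<close>. The values must lie in \<open>U\<close>, since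
  \<open>g\<close> is controlled only on \<open>UNIV \<times> U\<close>; for the same reason measurability of the integrand is
  obtained through the trace sigma-algebra on that set.\<close>

lemma integral_tendsto_AE_policies:
  fixes w :: "nat \<Rightarrow> 'a::euclidean_space \<Rightarrow> 'b::euclidean_space"
    and f :: "'a \<Rightarrow> real" and g :: "'a \<times> 'b \<Rightarrow> real"
  assumes U: "closed U"
    and w: "\<And>n. w n \<in> borel_measurable borel" "\<And>n x. w n x \<in> U"
    and v: "v \<in> borel_measurable borel" "\<And>x. v x \<in> U"
    and lim: "AE x in lebesgue. (\<lambda>n. w n x) \<longlonglongrightarrow> v x"
    and f: "integrable lebesgue f"
    and g: "continuous_on (UNIV \<times> U) g" "bounded (g ` (UNIV \<times> U))"
  shows "(\<lambda>n. \<integral>x. f x * g (x, w n x) \<partial>lebesgue) \<longlonglongrightarrow> (\<integral>x. f x * g (x, v x) \<partial>lebesgue)"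
proof -
  obtain B where B: "\<And>x u. u \<in> U \<Longrightarrow> \<bar>g (x, u)\<bar> \<le> B"
    using g(2) by (auto simp: bounded_iff)
  have meas: "(\<lambda>x. f x * g (x, u x)) \<in> borel_measurable lebesgue"
    if u: "u \<in> borel_measurable borel" "\<And>x. u x \<in> U" for u
  proof -
    have "(\<lambda>x. (x, u x)) \<in> borel \<rightarrow>\<^sub>M restrict_space borel (UNIV \<times> U)"
      using u by (intro measurable_restrict_space2) auto
    then have "(\<lambda>x. g (x, u x)) \<in> borel_measurable borel"
      by (rule measurable_compose[OF _ borel_measurable_continuous_on_restrict[OF g(1)]])
    then have "(\<lambda>x. g (x, u x)) \<in> borel_measurable lebesgue"
      by (intro measurable_completion) simp
    then show ?thesis
      using f by (intro borel_measurable_times) auto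
  qed
  show ?thesis
  proof (rule integral_dominated_convergence[where w = "\<lambda>x. norm (f x) * B"])
    show "AE x in lebesgue. (\<lambda>n. f x * g (x, w n x)) \<longlonglongrightarrow> f x * g (x, v x)"
      using lim
    proof eventually_elim
      case (elim x)
      have "(\<lambda>n. g (x, w n x)) \<longlonglongrightarrow> g (x, v x)"
        by (rule continuous_on_tendsto_compose[OF g(1)])
          (use elim w v in \<open>auto intro!: tendsto_Pair\<close>)
      then show ?case by (rule tendsto_mult_left)
    qed
    show "AE x in lebesgue. norm (f x * g (x, w n x)) \<le> norm (f x) * B" for n
      using B w by (auto simp: abs_mult intro!: mult_left_mono)
  qed (use f meas v w in auto)
qed

theorem theorem3p1:
  fixes U :: "(real ^ 'm) set" and v :: "real ^ 'd \<Rightarrow> real ^ 'm"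
  assumes "convex U" and "compact U"
    and "det_stationary_policy U v"
  shows "\<exists>vt :: nat \<Rightarrow> real \<Rightarrow> real ^ 'd \<Rightarrow> real ^ 'm.
    (\<forall>n. \<forall>\<eta>>0. det_stationary_policy U (vt n \<eta>) \<and>
        (\<exists>L. L-lipschitz_on UNIV (vt n \<eta>)) \<and> smooth (vt n \<eta>)) \<and>
    (\<forall>(f :: real ^ 'd \<Rightarrow> real) (g :: (real ^ 'd) \<times> (real ^ 'm) \<Rightarrow> real).
        integrable lebesgue f \<longrightarrow> integrable lebesgue (\<lambda>x. (f x)\<^sup>2) \<longrightarrow>
        continuous_on (UNIV \<times> U) g \<longrightarrow> bounded (g ` (UNIV \<times> U)) \<longrightarrow>
        (\<exists>l :: nat \<Rightarrow> real.
          (\<forall>n. ((\<lambda>\<eta>. \<integral>x. f x * g (x, vt n \<eta> x) \<partial>lebesgue) \<longlongrightarrow> l n) (at_right 0)) \<and>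
          l \<longlonglongrightarrow> (\<integral>x. f x * g (x, v x) \<partial>lebesgue)))"
proof -
  have closed: "closed U" using assms(2) by (rule compact_imp_closed)
  have policy_iff: "det_stationary_policy U u \<longleftrightarrow> u \<in> borel_measurable borel \<and> range u \<subseteq> U"
    for u :: "real ^ 'd \<Rightarrow> real ^ 'm"
    by (auto simp: det_stationary_policy_def measurable_restrict_space2_iff)
  have v: "v \<in> borel_measurable borel" "range v \<subseteq> U"
    using assms(3) by (auto simp: policy_iff)
  have "v \<in> borel_measurable lebesgue"
    using v(1) by (intro measurable_completion) simp
  from smooth_lipschitz_AE_limit[OF assms(1) closed this v(2)]
  obtain w :: "nat \<Rightarrow> real ^ 'd \<Rightarrow> real ^ 'm" where
    w: "\<And>n. range (w n) \<subseteq> U" "\<And>n. smooth (w n)" "\<And>n. \<exists>L. L-lipschitz_on UNIV (w n)"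
    and lim: "AE x in lebesgue. (\<lambda>n. w n x) \<longlonglongrightarrow> v x"
    by blast
  have meas: "w n \<in> borel_measurable borel" for n
    using w(3)[of n] by (auto intro: borel_measurable_continuous_onI lipschitz_on_continuous_on)
  have conv: "(\<lambda>n. \<integral>x. f x * g (x, w n x) \<partial>lebesgue) \<longlonglongrightarrow> (\<integral>x. f x * g (x, v x) \<partial>lebesgue)"
    if "integrable lebesgue f" "continuous_on (UNIV \<times> U) g" "bounded (g ` (UNIV \<times> U))"
    for f :: "real ^ 'd \<Rightarrow> real" and g :: "(real ^ 'd) \<times> (real ^ 'm) \<Rightarrow> real"
    using w(1) v(2) by (intro integral_tendsto_AE_policies[OF closed meas _ v(1) _ lim that]) auto
  show ?thesis
    by (rule exI[of _ "\<lambda>n \<eta>. w n"])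
      (use w meas conv in \<open>auto simp: policy_iff intro!: exI[of _ "\<lambda>n. \<integral>x. _ x * _ (x, w n x) \<partial>lebesgue"]\<close>)
qed

end
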